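(* There is an absolute constant $c>0$ such that for every $\kappa\ge1$ and every deterministic online algorithm $ALG$ for (unconstrained, $K=\mathbb{R}^d$) convex function chasing, there exist a dimension $d$, a starting point, and a finite sequence of $\kappa$-well-conditioned request functions on $\mathbb{R}^d$ on which the cost of $ALG$ is at least $c\,\kappa^{1/3}\cdot OPT$. That is, every algorithm for chasing convex functions with condition number at most $\kappa$ has competitive ratio $\Omega(\kappa^{1/3})$.
   Context: Convex function chasing in Euclidean space: a starting point $x_0\in\mathbb{R}^d$ is fixed; non-negative convex differentiable functions $f_1,\dots,f_T:\mathbb{R}^d\to[0,\infty)$ arrive one at a time, and after seeing $f_t$ (and only $f_1,\dots,f_t$) the online algorithm chooses $x_t\in\mathbb{R}^d$. The cost of $X=(x_1,\dots,x_T)$ is $\sum_{t=1}^T(\|x_t-x_{t-1}\|_2+f_t(x_t))$; $OPT$ is the infimum of this cost over all offline sequences with $y_0=x_0$. The competitive ratio of an algorithm is the supremum over instances of its cost divided by $OPT$. A differentiable $f$ is $\alpha$-strongly convex if $f(y)-f(x)-\langle\nabla f(x),y-x\rangle\ge\frac{\alpha}{2}\|x-y\|_2^2$ for all $x,y$, and $\beta$-smooth if the same quantity is $\le\frac{\beta}{2}\|x-y\|_2^2$; $f$ is $\kappa$-well-conditioned if it is $\alpha$-strongly convex and $\alpha\kappa$-smooth for some $\alpha>0$. *)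

theory Defs
  imports
    "HOL-Library.Extended_Real"
    "HOL-Library.FuncSet"
    "Jordan_Normal_Form.Matrix"
begin

text \<open>
  The dimension is chosen after the algorithm, so it has to be a bound variable:
  \<open>\<real>\<^sup>d\<close> is rendered as \<^term>\<open>carrier_vec d :: real vec set\<close>.
  Request functions are extensional, hence a term \<open>f\<close> with \<open>request d f\<close> is
  exactly a function \<open>\<real>\<^sup>d \<rightarrow> [0,\<infinity>)\<close>, with no extra information outside \<open>\<real>\<^sup>d\<close>.
\<close>

type_synonym func = "real vec \<Rightarrow> real"

definition norm2 :: "real vec \<Rightarrow> real" where
  "norm2 x = sqrt (x \<bullet> x)"

text \<open>Frechet differentiability on \<open>\<real>\<^sup>d\<close>, the derivative being \<open>h \<mapsto> \<langle>g, h\<rangle>\<close>.\<close>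

definition has_gradient :: "nat \<Rightarrow> func \<Rightarrow> real vec \<Rightarrow> real vec \<Rightarrow> bool" where
  "has_gradient d f g x \<longleftrightarrow> g \<in> carrier_vec d \<and>
     (\<forall>\<epsilon>>0. \<exists>\<delta>>0. \<forall>y\<in>carrier_vec d. norm2 (y - x) < \<delta> \<longrightarrow>
        \<bar>f y - f x - g \<bullet> (y - x)\<bar> \<le> \<epsilon> * norm2 (y - x))"

definition differentiable_fun :: "nat \<Rightarrow> func \<Rightarrow> bool" where
  "differentiable_fun d f \<longleftrightarrow> (\<forall>x\<in>carrier_vec d. \<exists>g. has_gradient d f g x)"

definition gradient :: "nat \<Rightarrow> func \<Rightarrow> real vec \<Rightarrow> real vec" where
  "gradient d f x = (THE g. has_gradient d f g x)"

definition convex_fun :: "nat \<Rightarrow> func \<Rightarrow> bool" where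
  "convex_fun d f \<longleftrightarrow> (\<forall>x\<in>carrier_vec d. \<forall>y\<in>carrier_vec d. \<forall>u\<in>{0..1}.
     f ((1 - u) \<cdot>\<^sub>v x + u \<cdot>\<^sub>v y) \<le> (1 - u) * f x + u * f y)"

definition strongly_convex :: "nat \<Rightarrow> real \<Rightarrow> func \<Rightarrow> bool" where
  "strongly_convex d \<alpha> f \<longleftrightarrow> differentiable_fun d f \<and>
     (\<forall>x\<in>carrier_vec d. \<forall>y\<in>carrier_vec d.
        f y - f x - gradient d f x \<bullet> (y - x) \<ge> \<alpha> / 2 * (norm2 (x - y))\<^sup>2)"

definition smooth_fun :: "nat \<Rightarrow> real \<Rightarrow> func \<Rightarrow> bool" where
  "smooth_fun d \<beta> f \<longleftrightarrow> differentiable_fun d f \<and>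
     (\<forall>x\<in>carrier_vec d. \<forall>y\<in>carrier_vec d.
        f y - f x - gradient d f x \<bullet> (y - x) \<le> \<beta> / 2 * (norm2 (x - y))\<^sup>2)"

definition well_conditioned :: "nat \<Rightarrow> real \<Rightarrow> func \<Rightarrow> bool" where
  "well_conditioned d \<kappa> f \<longleftrightarrow> (\<exists>\<alpha>>0. strongly_convex d \<alpha> f \<and> smooth_fun d (\<alpha> * \<kappa>) f)"

definition request :: "nat \<Rightarrow> func \<Rightarrow> bool" where
  "request d f \<longleftrightarrow> f \<in> carrier_vec d \<rightarrow>\<^sub>E {0..} \<and> convex_fun d f \<and> differentiable_fun d f"

text \<open>
  The request \<open>f\<^sub>t\<close> is \<open>fs ! (t - 1)\<close>; a solution is a sequence \<open>X\<close> with \<open>X 0\<close> the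
  starting point, of which only the entries up to \<^term>\<open>length fs\<close> matter.
\<close>

definition cost :: "func list \<Rightarrow> (nat \<Rightarrow> real vec) \<Rightarrow> real" where
  "cost fs X = (\<Sum>t=1..length fs. norm2 (X t - X (t - 1)) + (fs ! (t - 1)) (X t))"

definition OPT :: "nat \<Rightarrow> real vec \<Rightarrow> func list \<Rightarrow> real" where
  "OPT d x0 fs =
     Inf {cost fs Y | Y. Y 0 = x0 \<and> (\<forall>t\<in>{1..length fs}. Y t \<in> carrier_vec d)}"

text \<open>
  A deterministic online algorithm maps the starting point (whose \<^term>\<open>dim_vec\<close>
  reveals the dimension) and the requests \<open>[f\<^sub>1, \<dots>, f\<^sub>t]\<close> seen so far to \<open>x\<^sub>t\<close>. Its own
  earlier positions are determined by these data and need not be passed.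
\<close>

type_synonym alg = "real vec \<Rightarrow> func list \<Rightarrow> real vec"

definition online_algorithm :: "alg \<Rightarrow> bool" where
  "online_algorithm A \<longleftrightarrow> (\<forall>d x0 fs. 0 < d \<longrightarrow> x0 \<in> carrier_vec d \<longrightarrow> fs \<noteq> [] \<longrightarrow>
     (\<forall>f\<in>set fs. request d f) \<longrightarrow> A x0 fs \<in> carrier_vec d)"

definition trajectory :: "alg \<Rightarrow> real vec \<Rightarrow> func list \<Rightarrow> nat \<Rightarrow> real vec" where
  "trajectory A x0 fs t = (if t = 0 then x0 else A x0 (take t fs))"

definition alg_cost :: "alg \<Rightarrow> real vec \<Rightarrow> func list \<Rightarrow> real" where
  "alg_cost A x0 fs = cost fs (trajectory A x0 fs)"

definition wc_instance :: "real \<Rightarrow> nat \<Rightarrow> real vec \<Rightarrow> func list \<Rightarrow> bool" where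
  "wc_instance \<kappa> d x0 fs \<longleftrightarrow> 0 < d \<and> x0 \<in> carrier_vec d \<and>
     (\<forall>f\<in>set fs. request d f \<and> well_conditioned d \<kappa> f)"

text \<open>
  Division is that of \<^typ>\<open>ereal\<close>: an instance with \<open>OPT = 0\<close> contributes \<open>\<infinity>\<close> if the
  algorithm has positive cost, and \<open>0 / 0 = 0\<close>.
\<close>

definition competitive_ratio :: "real \<Rightarrow> alg \<Rightarrow> ereal" where
  "competitive_ratio \<kappa> A =
     Sup {ereal (alg_cost A x0 fs) / ereal (OPT d x0 fs) | d x0 fs. wc_instance \<kappa> d x0 fs}"

lemma norm2_nonneg: "norm2 x \<ge> 0"
  unfolding norm2_def scalar_prod_def by (simp add: sum_nonneg)

lemma norm2_smult: "norm2 (c \<cdot>\<^sub>v x) = \<bar>c\<bar> * norm2 x"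
proof -
  have "(c \<cdot>\<^sub>v x) \<bullet> (c \<cdot>\<^sub>v x) = c\<^sup>2 * (x \<bullet> x)"
    by (simp add: scalar_prod_def sum_distrib_left power2_eq_square algebra_simps)
  thus ?thesis by (simp add: norm2_def real_sqrt_mult)
qed

lemma has_gradient_unique:
  assumes g: "has_gradient d f g x" and g': "has_gradient d f g' x"
    and x: "x \<in> carrier_vec d"
  shows "g = g'"
proof -
  define h where "h = g - g'"
  have gc: "g \<in> carrier_vec d" "g' \<in> carrier_vec d"
    using g g' by (auto simp: has_gradient_def)
  have hc: "h \<in> carrier_vec d" using gc by (simp add: h_def)
  have hh: "h \<bullet> h \<ge> 0" by (simp add: scalar_prod_def sum_nonneg)
  have le: "norm2 h \<le> 2 * e" if e: "e > 0" for e
  proof (cases "norm2 h = 0")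
    case False
    hence n: "norm2 h > 0" using norm2_nonneg[of h] by linarith
    obtain d1 where d1: "d1 > 0" "\<And>y. y \<in> carrier_vec d \<Longrightarrow> norm2 (y - x) < d1 \<Longrightarrow>
        \<bar>f y - f x - g \<bullet> (y - x)\<bar> \<le> e * norm2 (y - x)"
      using g e unfolding has_gradient_def by blast
    obtain d2 where d2: "d2 > 0" "\<And>y. y \<in> carrier_vec d \<Longrightarrow> norm2 (y - x) < d2 \<Longrightarrow>
        \<bar>f y - f x - g' \<bullet> (y - x)\<bar> \<le> e * norm2 (y - x)"
      using g' e unfolding has_gradient_def by blast
    define t where "t = min d1 d2 / 2 / norm2 h"
    have t: "t > 0" using n d1 d2 by (simp add: t_def)
    have tn: "t * norm2 h < d1" "t * norm2 h < d2" using n d1 d2 by (auto simp: t_def min_def)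
    define y where "y = x + t \<cdot>\<^sub>v h"
    have yc: "y \<in> carrier_vec d" using x hc by (simp add: y_def)
    have yx: "y - x = t \<cdot>\<^sub>v h" using x hc by (auto simp: y_def intro!: eq_vecI)
    have ny: "norm2 (y - x) = t * norm2 h" using t by (simp add: yx norm2_smult)
    have "\<bar>g \<bullet> (y - x) - g' \<bullet> (y - x)\<bar> \<le> 2 * e * (t * norm2 h)"
      using d1(2)[OF yc] d2(2)[OF yc] tn unfolding ny by linarith
    moreover have "g \<bullet> (y - x) - g' \<bullet> (y - x) = t * (norm2 h)\<^sup>2"
    proof -
      have "g \<bullet> (y - x) - g' \<bullet> (y - x) = h \<bullet> (t \<cdot>\<^sub>v h)"
        unfolding yx h_def using gc hc minus_scalar_prod_distrib[of g d g' "t \<cdot>\<^sub>v h"]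
        by (simp add: h_def)
      also have "\<dots> = t * (h \<bullet> h)" using hc by simp
      finally show ?thesis using hh by (simp add: norm2_def)
    qed
    ultimately have "(t * norm2 h) * norm2 h \<le> (t * norm2 h) * (2 * e)"
      using t by (simp add: power2_eq_square algebra_simps)
    thus ?thesis using t n by simp
  qed (use e in simp)
  have "norm2 h \<le> 0"
    by (rule field_le_epsilon) (use le[of "_ / 2"] in auto)
  hence "h \<bullet> h = 0" using norm2_nonneg[of h] by (simp add: norm2_def)
  hence "\<forall>i<d. h $ i = 0"
    using hc by (simp add: scalar_prod_def sum_nonneg_eq_0_iff)
  thus ?thesis using gc by (auto simp: h_def intro!: eq_vecI)
qed

lemma gradient_eq:
  assumes "has_gradient d f g x" and "x \<in> carrier_vec d"
  shows "gradient d f x = g"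
  unfolding gradient_def using assms has_gradient_unique by blast

end

theory Submission
  imports Defs
begin

text \<open>
  Start at the origin. Request \<open>t\<close> is
  \<open>f\<^sub>t(x) = (1/2)((x\<^sub>t - s\<^sub>t)\<^sup>2 + (1/\<kappa>) \<Sum>\<^bsub>i\<noteq>t\<^esub> x\<^sub>i\<^sup>2)\<close>, where the sign \<open>s\<^sub>t = \<plusminus>1\<close> is chosen
  opposite to the \<open>t\<close>-th coordinate of the algorithm's current position. Whether the
  algorithm moves in this coordinate or not, the step costs it at least \<open>1/2\<close>,
  so \<open>d\<close> requests cost it at least \<open>d/2\<close>. Moving once to \<open>(s\<^sub>1, \<dots>, s\<^sub>d)\<close> costs only
  \<open>\<surd>d + d\<^sup>2/(2\<kappa>)\<close>. The two terms balance at \<open>d \<approx> \<kappa>\<^bsup>2/3\<^esup>\<close>, and the ratio is of order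
  \<open>\<surd>d = \<kappa>\<^bsup>1/3\<^esup>\<close>.
\<close>

section \<open>Euclidean norm and first-order conditions\<close>

lemma norm2_square: "(norm2 x)\<^sup>2 = (\<Sum>i<dim_vec x. (x $ i)\<^sup>2)"
  by (simp add: norm2_def scalar_prod_def sum_nonneg power2_eq_square atLeast0LessThan)

lemma abs_index_le_norm2:
  assumes "i < dim_vec x"
  shows "\<bar>x $ i\<bar> \<le> norm2 x"
proof (rule power2_le_imp_le[OF _ norm2_nonneg])
  have "(x $ i)\<^sup>2 \<le> (\<Sum>i<dim_vec x. (x $ i)\<^sup>2)"
    by (rule member_le_sum) (use assms in auto)
  thus "\<bar>x $ i\<bar>\<^sup>2 \<le> (norm2 x)\<^sup>2" by (simp add: norm2_square)
qed

lemma norm2_le_sqrt_dim: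
  assumes "\<And>i. i < dim_vec x \<Longrightarrow> \<bar>x $ i\<bar> \<le> b" and "0 \<le> b"
  shows "norm2 x \<le> sqrt (dim_vec x) * b"
proof (rule power2_le_imp_le)
  have "(norm2 x)\<^sup>2 \<le> (\<Sum>i<dim_vec x. b\<^sup>2)"
    unfolding norm2_square by (intro sum_mono) (use assms in \<open>simp flip: abs_le_square_iff\<close>)
  thus "(norm2 x)\<^sup>2 \<le> (sqrt (dim_vec x) * b)\<^sup>2" by (simp add: power_mult_distrib)
qed (use assms in simp)

lemma norm2_minus_commute:
  assumes "x \<in> carrier_vec d" and "y \<in> carrier_vec d"
  shows "norm2 (x - y) = norm2 (y - x)"
proof (rule power2_eq_imp_eq[OF _ norm2_nonneg norm2_nonneg])
  show "(norm2 (x - y))\<^sup>2 = (norm2 (y - x))\<^sup>2"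
    using assms by (auto simp: norm2_square power2_commute intro!: sum.cong)
qed

lemma has_gradient_if_quadratic_remainder:
  assumes g: "g \<in> carrier_vec d"
    and remainder: "\<And>y. y \<in> carrier_vec d \<Longrightarrow>
      \<bar>f y - f x - g \<bullet> (y - x)\<bar> \<le> b * (norm2 (y - x))\<^sup>2"
  shows "has_gradient d f g x"
  unfolding has_gradient_def
proof (intro conjI allI impI)
  show "g \<in> carrier_vec d" by (rule g)
  fix \<epsilon> :: real assume \<epsilon>: "\<epsilon> > 0"
  define \<delta> where "\<delta> = \<epsilon> / (\<bar>b\<bar> + 1)"
  have "\<bar>f y - f x - g \<bullet> (y - x)\<bar> \<le> \<epsilon> * norm2 (y - x)"
    if y: "y \<in> carrier_vec d" and near: "norm2 (y - x) < \<delta>" for y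
  proof -
    have "b * norm2 (y - x) \<le> (\<bar>b\<bar> + 1) * norm2 (y - x)"
      by (intro mult_right_mono norm2_nonneg) simp
    also have "\<dots> \<le> \<epsilon>" using near by (simp add: \<delta>_def field_simps)
    finally have "b * norm2 (y - x) * norm2 (y - x) \<le> \<epsilon> * norm2 (y - x)"
      by (intro mult_right_mono norm2_nonneg)
    thus ?thesis using remainder[OF y] by (simp add: power2_eq_square)
  qed
  moreover have "\<delta> > 0" using \<epsilon> by (simp add: \<delta>_def)
  ultimately show "\<exists>\<delta>>0. \<forall>y\<in>carrier_vec d. norm2 (y - x) < \<delta> \<longrightarrow>
      \<bar>f y - f x - g \<bullet> (y - x)\<bar> \<le> \<epsilon> * norm2 (y - x)"
    by blast
qed

lemma gradient_carrier:
  assumes "differentiable_fun d f" and "x \<in> carrier_vec d"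
  shows "gradient d f x \<in> carrier_vec d"
proof -
  obtain g where g: "has_gradient d f g x"
    using assms unfolding differentiable_fun_def by blast
  hence "g \<in> carrier_vec d" by (simp add: has_gradient_def)
  thus ?thesis using gradient_eq[OF g assms(2)] by simp
qed

lemma strongly_convex_imp_convex_fun:
  assumes f: "strongly_convex d \<alpha> f" and \<alpha>: "0 \<le> \<alpha>"
  shows "convex_fun d f"
  unfolding convex_fun_def
proof (intro ballI)
  fix x y :: "real vec" and u :: real
  assume x: "x \<in> carrier_vec d" and y: "y \<in> carrier_vec d" and u: "u \<in> {0..1}"
  define z where "z = (1 - u) \<cdot>\<^sub>v x + u \<cdot>\<^sub>v y"
  define g where "g = gradient d f z"
  have z: "z \<in> carrier_vec d" using x y by (simp add: z_def)
  have g: "g \<in> carrier_vec d"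
    using f gradient_carrier[OF _ z] by (simp add: g_def strongly_convex_def)
  have tangent: "f z + g \<bullet> (v - z) \<le> f v" if v: "v \<in> carrier_vec d" for v
  proof -
    have "0 \<le> \<alpha> / 2 * (norm2 (z - v))\<^sup>2" using \<alpha> by simp
    also have "\<dots> \<le> f v - f z - g \<bullet> (v - z)"
      using f z v by (simp add: strongly_convex_def g_def)
    finally show ?thesis by simp
  qed
  have "x - z = u \<cdot>\<^sub>v (x - y)" and "y - z = (u - 1) \<cdot>\<^sub>v (x - y)"
    using x y by (auto simp: z_def algebra_simps intro!: eq_vecI)
  hence gx: "g \<bullet> (x - z) = u * (g \<bullet> (x - y))" and gy: "g \<bullet> (y - z) = (u - 1) * (g \<bullet> (x - y))"
    using g x y by simp_all
  have "f z = (1 - u) * (f z + g \<bullet> (x - z)) + u * (f z + g \<bullet> (y - z))"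
    unfolding gx gy by (simp add: algebra_simps)
  also have "\<dots> \<le> (1 - u) * f x + u * f y"
    using u by (intro add_mono mult_left_mono tangent x y) auto
  finally show "f ((1 - u) \<cdot>\<^sub>v x + u \<cdot>\<^sub>v y) \<le> (1 - u) * f x + u * f y"
    by (simp add: z_def)
qed

section \<open>Separable quadratics\<close>

definition diag_quad :: "nat \<Rightarrow> (nat \<Rightarrow> real) \<Rightarrow> (nat \<Rightarrow> real) \<Rightarrow> func" where
  "diag_quad d w c = (\<lambda>x\<in>carrier_vec d. 1 / 2 * (\<Sum>i<d. w i * (x $ i - c i)\<^sup>2))"

definition diag_quad_grad ::
    "nat \<Rightarrow> (nat \<Rightarrow> real) \<Rightarrow> (nat \<Rightarrow> real) \<Rightarrow> real vec \<Rightarrow> real vec" where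
  "diag_quad_grad d w c x = vec d (\<lambda>i. w i * (x $ i - c i))"

lemma diag_quad_remainder:
  assumes "x \<in> carrier_vec d" and "y \<in> carrier_vec d"
  shows "diag_quad d w c y - diag_quad d w c x - diag_quad_grad d w c x \<bullet> (y - x) =
    1 / 2 * (\<Sum>i<d. w i * ((y - x) $ i)\<^sup>2)"
proof -
  have "diag_quad_grad d w c x \<bullet> (y - x) = (\<Sum>i<d. w i * (x $ i - c i) * (y $ i - x $ i))"
    using assms
    by (auto simp: diag_quad_grad_def scalar_prod_def atLeast0LessThan intro!: sum.cong)
  moreover have "(\<Sum>i<d. w i * ((y - x) $ i)\<^sup>2) = (\<Sum>i<d. w i * (y $ i - x $ i)\<^sup>2)"
    using assms by (auto intro!: sum.cong)
  ultimately show ?thesis using assms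
    by (simp add: diag_quad_def sum_distrib_left flip: sum_subtractf)
      (auto intro!: sum.cong simp: field_simps power2_eq_square)
qed

lemma has_gradient_diag_quad:
  assumes x: "x \<in> carrier_vec d"
  shows "has_gradient d (diag_quad d w c) (diag_quad_grad d w c x) x"
proof (rule has_gradient_if_quadratic_remainder)
  show "diag_quad_grad d w c x \<in> carrier_vec d" by (simp add: diag_quad_grad_def)
  fix y :: "real vec" assume y: "y \<in> carrier_vec d"
  have coord: "((y - x) $ i)\<^sup>2 \<le> (norm2 (y - x))\<^sup>2" if "i < d" for i
    using abs_index_le_norm2[of i "y - x"] that x
    by (simp add: norm2_nonneg flip: abs_le_square_iff)
  have "\<bar>\<Sum>i<d. w i * ((y - x) $ i)\<^sup>2\<bar> \<le> (\<Sum>i<d. \<bar>w i\<bar> * (norm2 (y - x))\<^sup>2)"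
    by (intro order_trans[OF sum_abs] sum_mono)
      (use coord in \<open>auto simp: abs_mult intro!: mult_left_mono\<close>)
  thus "\<bar>diag_quad d w c y - diag_quad d w c x - diag_quad_grad d w c x \<bullet> (y - x)\<bar>
      \<le> (\<Sum>i<d. \<bar>w i\<bar>) / 2 * (norm2 (y - x))\<^sup>2"
    unfolding diag_quad_remainder[OF x y] by (simp add: abs_mult sum_distrib_right)
qed

lemma differentiable_diag_quad: "differentiable_fun d (diag_quad d w c)"
  unfolding differentiable_fun_def using has_gradient_diag_quad by blast

lemma diag_quad_gradient_remainder:
  assumes "x \<in> carrier_vec d" and "y \<in> carrier_vec d"
  shows "diag_quad d w c y - diag_quad d w c x - gradient d (diag_quad d w c) x \<bullet> (y - x) =
    1 / 2 * (\<Sum>i<d. w i * ((y - x) $ i)\<^sup>2)"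
  using diag_quad_remainder[OF assms]
  by (simp add: gradient_eq[OF has_gradient_diag_quad[OF assms(1)] assms(1)])

lemma strongly_convex_diag_quad:
  assumes w: "\<And>i. i < d \<Longrightarrow> \<alpha> \<le> w i"
  shows "strongly_convex d \<alpha> (diag_quad d w c)"
  unfolding strongly_convex_def
proof (intro conjI ballI differentiable_diag_quad)
  fix x y :: "real vec" assume x: "x \<in> carrier_vec d" and y: "y \<in> carrier_vec d"
  have "\<alpha> * (norm2 (y - x))\<^sup>2 \<le> (\<Sum>i<d. w i * ((y - x) $ i)\<^sup>2)"
    using x unfolding norm2_square sum_distrib_left
    by (auto intro!: sum_mono mult_right_mono w)
  thus "\<alpha> / 2 * (norm2 (x - y))\<^sup>2 \<le>
      diag_quad d w c y - diag_quad d w c x - gradient d (diag_quad d w c) x \<bullet> (y - x)"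
    unfolding diag_quad_gradient_remainder[OF x y] norm2_minus_commute[OF x y] by simp
qed

lemma smooth_diag_quad:
  assumes w: "\<And>i. i < d \<Longrightarrow> w i \<le> \<beta>"
  shows "smooth_fun d \<beta> (diag_quad d w c)"
  unfolding smooth_fun_def
proof (intro conjI ballI differentiable_diag_quad)
  fix x y :: "real vec" assume x: "x \<in> carrier_vec d" and y: "y \<in> carrier_vec d"
  have "(\<Sum>i<d. w i * ((y - x) $ i)\<^sup>2) \<le> \<beta> * (norm2 (y - x))\<^sup>2"
    using x unfolding norm2_square sum_distrib_left
    by (auto intro!: sum_mono mult_right_mono w)
  thus "diag_quad d w c y - diag_quad d w c x - gradient d (diag_quad d w c) x \<bullet> (y - x)
      \<le> \<beta> / 2 * (norm2 (x - y))\<^sup>2"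
    unfolding diag_quad_gradient_remainder[OF x y] norm2_minus_commute[OF x y] by simp
qed

lemma well_conditioned_diag_quad:
  assumes "0 < \<alpha>" and "\<And>i. i < d \<Longrightarrow> \<alpha> \<le> w i" and "\<And>i. i < d \<Longrightarrow> w i \<le> \<alpha> * \<kappa>"
  shows "well_conditioned d \<kappa> (diag_quad d w c)"
  unfolding well_conditioned_def
  using assms strongly_convex_diag_quad smooth_diag_quad by blast

lemma request_diag_quad:
  assumes w: "\<And>i. i < d \<Longrightarrow> 0 \<le> w i"
  shows "request d (diag_quad d w c)"
  unfolding request_def
proof (intro conjI differentiable_diag_quad)
  show "diag_quad d w c \<in> carrier_vec d \<rightarrow>\<^sub>E {0..}"
    using w by (auto simp: diag_quad_def intro!: sum_nonneg)
  show "convex_fun d (diag_quad d w c)"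
    by (rule strongly_convex_imp_convex_fun[OF strongly_convex_diag_quad[OF w]]) simp_all
qed

lemma diag_quad_ge_coord:
  assumes w: "\<And>i. i < d \<Longrightarrow> 0 \<le> w i" and x: "x \<in> carrier_vec d" and n: "n < d"
  shows "1 / 2 * (w n * (x $ n - c n)\<^sup>2) \<le> diag_quad d w c x"
proof -
  have "w n * (x $ n - c n)\<^sup>2 \<le> (\<Sum>i<d. w i * (x $ i - c i)\<^sup>2)"
    by (rule member_le_sum) (use w n in auto)
  thus ?thesis using x by (simp add: diag_quad_def)
qed

lemma diag_quad_step_cost_ge:
  assumes w: "\<And>i. i < d \<Longrightarrow> 0 \<le> w i" and x: "x \<in> carrier_vec d" and y: "y \<in> carrier_vec d"
    and n: "n < d" and wn: "1 \<le> w n" and far: "1 \<le> \<bar>x $ n - c n\<bar>"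
  shows "1 / 2 \<le> norm2 (y - x) + diag_quad d w c y"
proof -
  define u where "u = \<bar>y $ n - c n\<bar>"
  have "\<bar>(y - x) $ n\<bar> \<le> norm2 (y - x)" by (rule abs_index_le_norm2) (use n x in simp)
  hence moved: "1 - u \<le> norm2 (y - x)" using far x n by (simp add: u_def)
  have "u\<^sup>2 \<le> w n * u\<^sup>2" using mult_right_mono[OF wn, of "u\<^sup>2"] by simp
  hence paid: "1 / 2 * u\<^sup>2 \<le> diag_quad d w c y"
    using diag_quad_ge_coord[where w = w and c = c, OF w y n] by (simp add: u_def)
  have "0 \<le> (1 - u)\<^sup>2" by simp
  hence "1 / 2 \<le> (1 - u) + 1 / 2 * u\<^sup>2" by (simp add: power2_eq_square algebra_simps)
  thus ?thesis using moved paid by linarith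
qed

section \<open>Cost and offline optimum\<close>

lemma cost_Nil [simp]: "cost [] X = 0"
  by (simp add: cost_def)

lemma cost_Cons:
  "cost (f # fs) X = norm2 (X 1 - X 0) + f (X 1) + cost fs (\<lambda>t. X (Suc t))"
  unfolding cost_def One_nat_def sum.atLeast1_atMost_eq length_Cons sum.lessThan_Suc_shift by simp

lemma cost_nonneg:
  assumes "\<forall>f\<in>set fs. request d f" and "\<And>t. t \<in> {1..length fs} \<Longrightarrow> X t \<in> carrier_vec d"
  shows "0 \<le> cost fs X"
  using assms
proof (induction fs arbitrary: X)
  case (Cons f fs)
  have "0 \<le> f (X 1)" using Cons.prems by (auto simp: request_def PiE_iff)
  moreover have "0 \<le> cost fs (\<lambda>t. X (Suc t))" by (rule Cons.IH) (use Cons.prems in auto)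
  ultimately show ?case by (simp add: cost_Cons norm2_nonneg)
qed simp

lemma cost_stationary:
  assumes "p \<in> carrier_vec d"
  shows "cost fs (\<lambda>_. p) = (\<Sum>f\<leftarrow>fs. f p)"
proof (induction fs)
  case (Cons f fs)
  have "norm2 (p - p) = 0" using assms by (simp add: norm2_def)
  thus ?case using Cons.IH by (simp add: cost_Cons)
qed simp

definition feasible :: "nat \<Rightarrow> real vec \<Rightarrow> func list \<Rightarrow> (nat \<Rightarrow> real vec) set" where
  "feasible d x0 fs = {Y. Y 0 = x0 \<and> (\<forall>t\<in>{1..length fs}. Y t \<in> carrier_vec d)}"

lemma OPT_eq_INF: "OPT d x0 fs = (INF Y\<in>feasible d x0 fs. cost fs Y)"
  by (simp add: OPT_def feasible_def image_Collect)

lemma OPT_le_cost: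
  assumes "\<forall>f\<in>set fs. request d f" and "Y \<in> feasible d x0 fs"
  shows "OPT d x0 fs \<le> cost fs Y"
  unfolding OPT_eq_INF
proof (rule cINF_lower[OF _ assms(2)])
  show "bdd_below (cost fs ` feasible d x0 fs)"
    by (rule bdd_belowI2[of _ 0]) (use assms(1) in \<open>auto simp: feasible_def intro: cost_nonneg\<close>)
qed

lemma OPT_ge_first_step:
  assumes fs: "\<forall>f\<in>set (f # fs). request d f"
    and step: "\<And>y. y \<in> carrier_vec d \<Longrightarrow> b \<le> norm2 (y - x0) + f y"
  shows "b \<le> OPT d x0 (f # fs)"
  unfolding OPT_eq_INF
proof (rule cINF_greatest)
  have "(\<lambda>t. if t = 0 then x0 else 0\<^sub>v d) \<in> feasible d x0 (f # fs)"
    by (simp add: feasible_def)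
  thus "feasible d x0 (f # fs) \<noteq> {}" by blast
next
  fix Y assume Y: "Y \<in> feasible d x0 (f # fs)"
  hence "b \<le> norm2 (Y 1 - Y 0) + f (Y 1)" by (simp add: feasible_def step)
  moreover have "0 \<le> cost fs (\<lambda>t. Y (Suc t))"
    using fs Y by (auto simp: feasible_def intro!: cost_nonneg)
  ultimately show "b \<le> cost (f # fs) Y" by (simp add: cost_Cons)
qed

lemma OPT_le_single_move:
  assumes fs: "\<forall>f\<in>set fs. request d f" and p: "p \<in> carrier_vec d"
  shows "OPT d x0 fs \<le> norm2 (p - x0) + (\<Sum>f\<leftarrow>fs. f p)"
proof -
  let ?Y = "\<lambda>t :: nat. if t = 0 then x0 else p"
  have "OPT d x0 fs \<le> cost fs ?Y"
    by (rule OPT_le_cost[OF fs]) (simp add: feasible_def p)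
  also have "\<dots> \<le> norm2 (p - x0) + (\<Sum>f\<leftarrow>fs. f p)"
    by (cases fs) (simp_all add: cost_Cons cost_stationary[OF p] norm2_nonneg)
  finally show ?thesis .
qed

lemma competitive_ratio_ge:
  assumes "wc_instance \<kappa> d x0 fs" and "OPT d x0 fs > 0"
    and "r * OPT d x0 fs \<le> alg_cost A x0 fs"
  shows "ereal r \<le> competitive_ratio \<kappa> A"
proof -
  have "ereal r \<le> ereal (alg_cost A x0 fs) / ereal (OPT d x0 fs)"
    using assms(2,3) by (simp add: field_simps)
  also have "\<dots> \<le> competitive_ratio \<kappa> A"
    unfolding competitive_ratio_def by (rule Sup_upper) (use assms(1) in blast)
  finally show ?thesis .
qed

section \<open>Adaptive adversaries\<close>

primrec adaptive_requests ::
    "(nat \<Rightarrow> real vec \<Rightarrow> func) \<Rightarrow> alg \<Rightarrow> real vec \<Rightarrow> nat \<Rightarrow> func list" where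
  "adaptive_requests g A x0 0 = []"
| "adaptive_requests g A x0 (Suc n) = adaptive_requests g A x0 n @
     [g n (trajectory A x0 (adaptive_requests g A x0 n) n)]"

lemma length_adaptive_requests [simp]: "length (adaptive_requests g A x0 m) = m"
  by (induction m) auto

lemma trajectory_append:
  "t \<le> length fs \<Longrightarrow> trajectory A x0 (fs @ gs) t = trajectory A x0 fs t"
  by (simp add: trajectory_def)

lemma adaptive_requests_conv_map:
  "adaptive_requests g A x0 m =
     map (\<lambda>n. g n (trajectory A x0 (adaptive_requests g A x0 m) n)) [0..<m]"
proof (induction m)
  case (Suc m)
  have "map (\<lambda>n. g n (trajectory A x0 (adaptive_requests g A x0 (Suc m)) n)) [0..<m] =
      map (\<lambda>n. g n (trajectory A x0 (adaptive_requests g A x0 m) n)) [0..<m]"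
    by (simp add: trajectory_append)
  thus ?case using Suc.IH by (simp add: trajectory_append)
qed simp

lemma trajectory_carrier:
  assumes "online_algorithm A" and "0 < d" and "x0 \<in> carrier_vec d"
    and "\<forall>f\<in>set fs. request d f" and "t \<le> length fs"
  shows "trajectory A x0 fs t \<in> carrier_vec d"
proof (cases "t = 0")
  case False
  hence "take t fs \<noteq> []" using assms(5) by auto
  moreover have "\<forall>f\<in>set (take t fs). request d f" using assms(4) by (meson in_set_takeD)
  ultimately show ?thesis
    using assms(1-3) False by (simp add: trajectory_def online_algorithm_def)
qed (simp add: trajectory_def assms(3))

lemma alg_cost_adaptive_requests_ge:
  assumes A: "online_algorithm A" and d: "0 < d" and x0: "x0 \<in> carrier_vec d"
    and request: "\<And>n x. n < m \<Longrightarrow> request d (g n x)"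
    and step: "\<And>n x y. n < m \<Longrightarrow> x \<in> carrier_vec d \<Longrightarrow> y \<in> carrier_vec d \<Longrightarrow>
      b \<le> norm2 (y - x) + g n x y"
  shows "real m * b \<le> alg_cost A x0 (adaptive_requests g A x0 m)"
proof -
  define fs where "fs = adaptive_requests g A x0 m"
  define X where "X = trajectory A x0 fs"
  have fs: "fs = map (\<lambda>n. g n (X n)) [0..<m]"
    using adaptive_requests_conv_map[of g A x0 m] by (simp add: fs_def X_def)
  have X: "X t \<in> carrier_vec d" if "t \<le> m" for t
    unfolding X_def using that request
    by (intro trajectory_carrier[OF A d x0]) (auto simp: fs)
  have "b \<le> norm2 (X t - X (t - 1)) + (fs ! (t - 1)) (X t)" if "t \<in> {1..m}" for t
    using that step[of "t - 1" "X (t - 1)" "X t"] X[of t] X[of "t - 1"] by (auto simp: fs)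
  hence "(\<Sum>t = 1..m. b) \<le> cost fs X"
    by (simp add: cost_def fs_def del: sum_constant) (rule sum_mono, simp)
  thus ?thesis by (simp add: alg_cost_def fs_def X_def)
qed

section \<open>The lower bound\<close>

definition spike :: "real \<Rightarrow> nat \<Rightarrow> nat \<Rightarrow> real \<Rightarrow> func" where
  "spike \<kappa> d n s = diag_quad d ((\<lambda>_. 1 / \<kappa>)(n := 1)) ((\<lambda>_. 0)(n := s))"

lemma request_spike: "\<kappa> \<ge> 1 \<Longrightarrow> request d (spike \<kappa> d n s)"
  by (simp add: spike_def request_diag_quad)

lemma well_conditioned_spike: "\<kappa> \<ge> 1 \<Longrightarrow> well_conditioned d \<kappa> (spike \<kappa> d n s)"
  unfolding spike_def by (rule well_conditioned_diag_quad[where \<alpha> = "1 / \<kappa>"]) auto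

lemma spike_step_cost_ge:
  assumes "\<kappa> \<ge> 1" and "x \<in> carrier_vec d" and "y \<in> carrier_vec d" and "n < d"
    and "1 \<le> \<bar>x $ n - s\<bar>"
  shows "1 / 2 \<le> norm2 (y - x) + spike \<kappa> d n s y"
  unfolding spike_def by (rule diag_quad_step_cost_ge[where n = n]) (use assms in auto)

lemma spike_le_at_signs:
  assumes \<kappa>: "\<kappa> \<ge> 1" and s: "\<And>i. \<bar>s i\<bar> \<le> 1"
  shows "spike \<kappa> d n (s n) (vec d s) \<le> real d / (2 * \<kappa>)"
proof -
  have "(\<Sum>i<d. ((\<lambda>_. 1 / \<kappa>)(n := 1)) i * (vec d s $ i - ((\<lambda>_. 0)(n := s n)) i)\<^sup>2)
      \<le> (\<Sum>i<d. 1 / \<kappa>)"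
    by (rule sum_mono) (use \<kappa> s in \<open>auto simp: abs_square_le_1 divide_right_mono\<close>)
  thus ?thesis by (simp add: spike_def diag_quad_def)
qed

lemma OPT_spikes_le:
  assumes \<kappa>: "\<kappa> \<ge> 1" and s: "\<And>i. \<bar>s i\<bar> \<le> 1"
  shows "OPT d (0\<^sub>v d) (map (\<lambda>n. spike \<kappa> d n (s n)) [0..<m])
    \<le> sqrt d + real m * (real d / (2 * \<kappa>))"
proof -
  let ?fs = "map (\<lambda>n. spike \<kappa> d n (s n)) [0..<m]" and ?p = "vec d s"
  have "OPT d (0\<^sub>v d) ?fs \<le> norm2 (?p - 0\<^sub>v d) + (\<Sum>f\<leftarrow>?fs. f ?p)"
    by (rule OPT_le_single_move) (use request_spike[OF \<kappa>] in auto)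
  also have "norm2 (?p - 0\<^sub>v d) \<le> sqrt d"
    using norm2_le_sqrt_dim[of "?p - 0\<^sub>v d" 1] s by simp
  also have "(\<Sum>f\<leftarrow>?fs. f ?p) \<le> (\<Sum>f\<leftarrow>?fs. real d / (2 * \<kappa>))"
    by (rule sum_list_mono) (use spike_le_at_signs[OF \<kappa> s] in auto)
  finally show ?thesis by (simp add: comp_def sum_list_triv)
qed

definition opposite_sign :: "real \<Rightarrow> real" where
  "opposite_sign x = (if x \<ge> 0 then -1 else 1)"

lemma abs_opposite_sign [simp]: "\<bar>opposite_sign x\<bar> = 1"
  by (simp add: opposite_sign_def)

lemma abs_diff_opposite_sign_ge: "1 \<le> \<bar>x - opposite_sign x\<bar>"
  by (simp add: opposite_sign_def)

definition evading_spike :: "real \<Rightarrow> nat \<Rightarrow> nat \<Rightarrow> real vec \<Rightarrow> func" where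
  "evading_spike \<kappa> d n x = spike \<kappa> d n (opposite_sign (x $ n))"

definition evading_spikes :: "real \<Rightarrow> nat \<Rightarrow> alg \<Rightarrow> func list" where
  "evading_spikes \<kappa> d A = adaptive_requests (evading_spike \<kappa> d) A (0\<^sub>v d) d"

lemma evading_spike_step_cost_ge:
  assumes "\<kappa> \<ge> 1" and "n < d" and "x \<in> carrier_vec d" and "y \<in> carrier_vec d"
  shows "1 / 2 \<le> norm2 (y - x) + evading_spike \<kappa> d n x y"
  unfolding evading_spike_def
  by (intro spike_step_cost_ge abs_diff_opposite_sign_ge assms)

lemma evading_spikesE:
  obtains X where "evading_spikes \<kappa> d A = map (\<lambda>n. evading_spike \<kappa> d n (X n)) [0..<d]"
    and "X 0 = 0\<^sub>v d"
  using adaptive_requests_conv_map[of "evading_spike \<kappa> d" A "0\<^sub>v d" d]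
  by (metis evading_spikes_def trajectory_def)

lemma wc_instance_evading_spikes:
  assumes "\<kappa> \<ge> 1" and "0 < d"
  shows "wc_instance \<kappa> d (0\<^sub>v d) (evading_spikes \<kappa> d A)"
proof -
  obtain X where "evading_spikes \<kappa> d A = map (\<lambda>n. evading_spike \<kappa> d n (X n)) [0..<d]"
    by (rule evading_spikesE)
  thus ?thesis using assms
    by (auto simp: wc_instance_def evading_spike_def request_spike well_conditioned_spike)
qed

lemma alg_cost_evading_spikes_ge:
  assumes "\<kappa> \<ge> 1" and "0 < d" and "online_algorithm A"
  shows "real d / 2 \<le> alg_cost A (0\<^sub>v d) (evading_spikes \<kappa> d A)"
proof -
  have "real d * (1 / 2) \<le> alg_cost A (0\<^sub>v d) (evading_spikes \<kappa> d A)"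
    unfolding evading_spikes_def
  proof (rule alg_cost_adaptive_requests_ge)
    show "request d (evading_spike \<kappa> d n x)" for n x
      by (simp add: evading_spike_def request_spike assms)
  qed (intro evading_spike_step_cost_ge zero_carrier_vec assms | assumption)+
  thus ?thesis by simp
qed

lemma OPT_evading_spikes_ge:
  assumes \<kappa>: "\<kappa> \<ge> 1" and d: "0 < d"
  shows "1 / 2 \<le> OPT d (0\<^sub>v d) (evading_spikes \<kappa> d A)"
proof -
  obtain X where X: "evading_spikes \<kappa> d A = map (\<lambda>n. evading_spike \<kappa> d n (X n)) [0..<d]"
    and X0: "X 0 = 0\<^sub>v d"
    by (rule evading_spikesE)
  obtain fs where fs: "evading_spikes \<kappa> d A = evading_spike \<kappa> d 0 (0\<^sub>v d) # fs"
    using d X0 by (simp add: X upt_conv_Cons)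
  show ?thesis unfolding fs
  proof (rule OPT_ge_first_step)
    show "\<forall>f\<in>set (evading_spike \<kappa> d 0 (0\<^sub>v d) # fs). request d f"
      using wc_instance_evading_spikes[OF \<kappa> d, of A] by (simp add: wc_instance_def fs)
  qed (intro evading_spike_step_cost_ge \<kappa> d zero_carrier_vec)
qed

lemma OPT_evading_spikes_le:
  assumes "\<kappa> \<ge> 1"
  shows "OPT d (0\<^sub>v d) (evading_spikes \<kappa> d A) \<le> sqrt d + (real d)\<^sup>2 / (2 * \<kappa>)"
proof -
  obtain X where "evading_spikes \<kappa> d A = map (\<lambda>n. evading_spike \<kappa> d n (X n)) [0..<d]"
    by (rule evading_spikesE)
  thus ?thesis
    using OPT_spikes_le[OF assms, of "\<lambda>n. opposite_sign (X n $ n)" d d]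
    by (simp add: evading_spike_def power2_eq_square)
qed

lemma balanced_dimension:
  fixes \<kappa> :: real
  assumes \<kappa>: "\<kappa> \<ge> 1"
  obtains d :: nat where "0 < d" and "(real d)\<^sup>2 / \<kappa> \<le> sqrt d" and "\<kappa> powr (1 / 3) \<le> 2 * sqrt d"
proof -
  define r where "r = \<kappa> powr (1 / 3)"
  define d where "d = nat \<lfloor>r\<^sup>2\<rfloor>"
  have r: "r \<ge> 1" using \<kappa> by (simp add: r_def ge_one_powr_ge_zero)
  have r_cubed: "r ^ 3 = \<kappa>" using \<kappa> by (simp add: r_def powr_powr flip: powr_realpow)
  have "r\<^sup>2 \<ge> 1" using r by simp
  hence d: "0 < d" and d_le: "real d \<le> r\<^sup>2" and less_d: "r\<^sup>2 < real d + 1"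
    unfolding d_def by linarith+
  have "sqrt d \<le> r" using d_le r by (simp add: real_le_lsqrt)
  hence cube_le: "sqrt d ^ 3 \<le> \<kappa>" unfolding r_cubed[symmetric] by (intro power_mono) auto
  have "(real d)\<^sup>2 = sqrt d * sqrt d ^ 3" by (simp add: power2_eq_square power3_eq_cube)
  also have "\<dots> \<le> sqrt d * \<kappa>" by (intro mult_left_mono cube_le) simp
  finally have "(real d)\<^sup>2 / \<kappa> \<le> sqrt d" using \<kappa> by (simp add: field_simps)
  moreover have "r\<^sup>2 \<le> (2 * sqrt d)\<^sup>2" using less_d d by (simp add: power_mult_distrib)
  hence "r \<le> 2 * sqrt d" by (rule power2_le_imp_le) simp
  ultimately show ?thesis using that[OF d] by (simp add: r_def)
qed

theorem theorem2:
  shows "\<exists>c::real. c > 0 \<and> (\<forall>\<kappa>\<ge>1. \<forall>ALG. online_algorithm ALG \<longrightarrow>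
           (\<exists>d x0 fs. wc_instance \<kappa> d x0 fs \<and> OPT d x0 fs > 0 \<and>
              alg_cost ALG x0 fs \<ge> c * \<kappa> powr (1 / 3) * OPT d x0 fs) \<and>
           competitive_ratio \<kappa> ALG \<ge> ereal (c * \<kappa> powr (1 / 3)))"
proof (intro exI[of _ "1 / 6"] conjI allI impI)
  fix \<kappa> :: real and A :: alg
  assume \<kappa>: "\<kappa> \<ge> 1" and A: "online_algorithm A"
  obtain d :: nat where d: "0 < d" and balanced: "(real d)\<^sup>2 / \<kappa> \<le> sqrt d"
    and root_le: "\<kappa> powr (1 / 3) \<le> 2 * sqrt d"
    using balanced_dimension[OF \<kappa>] .
  let ?fs = "evading_spikes \<kappa> d A"
  have inst: "wc_instance \<kappa> d (0\<^sub>v d) ?fs" by (rule wc_instance_evading_spikes[OF \<kappa> d])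
  have pos: "OPT d (0\<^sub>v d) ?fs > 0" using OPT_evading_spikes_ge[OF \<kappa> d, of A] by linarith
  have "OPT d (0\<^sub>v d) ?fs \<le> 3 / 2 * sqrt d"
    using OPT_evading_spikes_le[OF \<kappa>, of d A] balanced by simp
  hence "1 / 6 * \<kappa> powr (1 / 3) * OPT d (0\<^sub>v d) ?fs \<le> 1 / 6 * (2 * sqrt d) * (3 / 2 * sqrt d)"
    using root_le pos by (intro mult_mono) auto
  also have "\<dots> = real d / 2" by simp
  also have "\<dots> \<le> alg_cost A (0\<^sub>v d) ?fs" by (rule alg_cost_evading_spikes_ge[OF \<kappa> d A])
  finally have ratio: "1 / 6 * \<kappa> powr (1 / 3) * OPT d (0\<^sub>v d) ?fs \<le> alg_cost A (0\<^sub>v d) ?fs" .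
  show "\<exists>d x0 fs. wc_instance \<kappa> d x0 fs \<and> OPT d x0 fs > 0 \<and>
      alg_cost A x0 fs \<ge> 1 / 6 * \<kappa> powr (1 / 3) * OPT d x0 fs"
    using inst pos ratio by blast
  show "competitive_ratio \<kappa> A \<ge> ereal (1 / 6 * \<kappa> powr (1 / 3))"
    by (rule competitive_ratio_ge[OF inst pos ratio])
qed simp

end
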